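(* Let $n\ge 1$. The non-adaptive complexity of the problem $P_n(?\rightarrow 1)$ in the case of at most one lie is $2n+1$. That is: there is a multi-family of $2n+1$ subsets of $[n]=\{1,\dots,n\}$ that solves the problem $P_n(?\rightarrow 1)$ with at most one lie, and every multi-family of subsets of $[n]$ solving this problem has at least $2n+1$ members (counted with multiplicity).
   Context: Problem $P_n(?\rightarrow 1)$ with at most one lie: an unknown set $T\subseteq[n]$ of "excellent" elements is given (possibly empty, size unknown). A non-adaptive algorithm is a finite multi-family $\mathcal F$ of subsets of $[n]$ (a set may occur several times; $|\mathcal F|$ counts multiplicity). For each member $F$ of $\mathcal F$ (each copy separately) the question "does $F$ contain at least one excellent element, i.e. is $F\cap T\neq\emptyset$?" is asked, and answered YES or NO; all answers are correct with at most one exception. Given an answer sequence, call $T\subseteq[n]$ consistent if the number of members $F$ (counted with multiplicity) whose answer differs from the truth value of "$F\cap T\ne\emptyset$" is at most one. The multi-family $\mathcal F$ solves the problem if for every possible answer sequence, either there is an element $x\in[n]$ belonging to every consistent $T$ (an excellent element is found), or every consistent $T$ is empty (one can claim there is no excellent element). The non-adaptive complexity is the minimum of $|\mathcal F|$ over all multi-families $\mathcal F$ solving the problem. *)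

theory Defs
  imports Main
begin

text \<open>
  The ground set $[n]$ is \<open>{1..n}\<close>. A finite multi-family of subsets is given as a list of sets,
  so that each copy of a set is a separate entry (\<open>length\<close> counts multiplicity); an answer
  sequence is a Boolean list of the same length (\<open>True\<close> is YES). The order of the entries is
  irrelevant.
\<close>

definition multifamily :: "nat \<Rightarrow> nat set list \<Rightarrow> bool" where
  "multifamily n Fs \<longleftrightarrow> (\<forall>F \<in> set Fs. F \<subseteq> {1..n})"

definition num_lies :: "nat set list \<Rightarrow> bool list \<Rightarrow> nat set \<Rightarrow> nat" where
  "num_lies Fs as T = card {i. i < length Fs \<and> as ! i \<noteq> (Fs ! i \<inter> T \<noteq> {})}"

definition consistent :: "nat \<Rightarrow> nat set list \<Rightarrow> bool list \<Rightarrow> nat set \<Rightarrow> bool" where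
  "consistent n Fs as T \<longleftrightarrow> T \<subseteq> {1..n} \<and> num_lies Fs as T \<le> 1"

text \<open>
  Answer sequences with no consistent set cannot occur; they are not excluded below since they
  satisfy the requirement vacuously.
\<close>

definition solves :: "nat \<Rightarrow> nat set list \<Rightarrow> bool" where
  "solves n Fs \<longleftrightarrow> multifamily n Fs \<and>
     (\<forall>as. length as = length Fs \<longrightarrow>
        (\<exists>x \<in> {1..n}. \<forall>T. consistent n Fs as T \<longrightarrow> x \<in> T) \<or>
        (\<forall>T. consistent n Fs as T \<longrightarrow> T = {}))"

definition nonadaptive_complexity :: "nat \<Rightarrow> nat" where
  "nonadaptive_complexity n = (LEAST m. \<exists>Fs. solves n Fs \<and> length Fs = m)"

end

theory Submission
  imports Defs
begin

text \<open>
  Lower bound: answer every question as if all elements were excellent. Some \<open>x\<close> is then in every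
  consistent set, so the set of all elements but \<open>x\<close> contradicts two answers; that is, two questions
  are equivalent to \<open>{x}\<close>. Answering NO to both removes \<open>x\<close> at the cost of two questions, and for
  a single element two questions do not suffice.
  Upper bound: ask every singleton twice and the whole set once.
\<close>

section \<open>Lower bound: removing an element together with two questions\<close>

definition lies :: "'i set \<Rightarrow> ('i \<Rightarrow> 'a set) \<Rightarrow> ('i \<Rightarrow> bool) \<Rightarrow> 'a set \<Rightarrow> 'i set" where
  "lies I F a T = {i \<in> I. a i \<noteq> (F i \<inter> T \<noteq> {})}"

definition determines :: "'a set \<Rightarrow> 'i set \<Rightarrow> ('i \<Rightarrow> 'a set) \<Rightarrow> bool" where
  "determines S I F \<longleftrightarrow>
     (\<forall>a. (\<exists>x\<in>S. \<forall>T. T \<subseteq> S \<and> card (lies I F a T) \<le> 1 \<longrightarrow> x \<in> T) \<or>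
          (\<forall>T. T \<subseteq> S \<and> card (lies I F a T) \<le> 1 \<longrightarrow> T = {}))"

lemma determinesE:
  assumes "determines S I F" "T \<subseteq> S" "card (lies I F a T) \<le> 1" "T \<noteq> {}"
  obtains x where "x \<in> S" "\<And>U. U \<subseteq> S \<Longrightarrow> card (lies I F a U) \<le> 1 \<Longrightarrow> x \<in> U"
  using assms unfolding determines_def by meson

lemma determines_two_singletons:
  assumes "determines S I F" "S \<noteq> {}"
  obtains x i j where "x \<in> S" "i \<in> I" "j \<in> I" "i \<noteq> j" "F i \<inter> S = {x}" "F j \<inter> S = {x}"
proof -
  let ?a = "\<lambda>i. F i \<inter> S \<noteq> {}"
  have "card (lies I F ?a S) \<le> 1"
    by (simp add: lies_def)
  then obtain x where x: "x \<in> S" "\<And>U. U \<subseteq> S \<Longrightarrow> card (lies I F ?a U) \<le> 1 \<Longrightarrow> x \<in> U"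
    using determinesE[OF assms(1) subset_refl _ assms(2)] by blast
  let ?L = "lies I F ?a (S - {x})"
  have gt: "card ?L \<ge> 2"
    using x(2)[of "S - {x}"] by fastforce
  then obtain i where i: "i \<in> ?L"
    by fastforce
  with gt have "\<not> ?L \<subseteq> {i}"
    using card_mono[of "{i}" ?L] by fastforce
  then obtain j where j: "j \<in> ?L" "j \<noteq> i"
    by blast
  \<comment> \<open>A lie at \<open>k\<close> means that \<open>F k\<close> meets \<open>S\<close>
    but misses \<open>S - {x}\<close>.\<close>
  have "k \<in> I \<and> F k \<inter> S = {x}" if "k \<in> ?L" for k
    using that by (auto simp: lies_def)
  with x(1) i j show thesis
    using that by metis
qed

text \<open>The questions \<open>i\<close> and \<open>j\<close> miss every subset of
  \<open>S - {x}\<close>, so answering NO to both is truthful there. Extending the answers in this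
  way leaves the lies about such sets unchanged.\<close>

lemma determines_remove:
  assumes det: "determines S I F" and F: "F i \<inter> S = {x}" "F j \<inter> S = {x}"
  shows "determines (S - {x}) (I - {i, j}) F"
proof -
  have lies_eq: "lies I F (\<lambda>k. k \<notin> {i, j} \<and> a k) T = lies (I - {i, j}) F a T"
    if "T \<subseteq> S - {x}" for a T
    using that F by (auto simp: lies_def)
  show ?thesis
    unfolding determines_def
  proof (intro allI disjCI)
    fix a
    assume "\<not> (\<forall>T. T \<subseteq> S - {x} \<and> card (lies (I - {i, j}) F a T) \<le> 1 \<longrightarrow> T = {})"
    then obtain T where T: "T \<subseteq> S - {x}" "card (lies (I - {i, j}) F a T) \<le> 1" "T \<noteq> {}"
      by blast
    then obtain y where y: "y \<in> S"
      "\<And>U. U \<subseteq> S \<Longrightarrow> card (lies I F (\<lambda>k. k \<notin> {i, j} \<and> a k) U) \<le> 1 \<Longrightarrow> y \<in> U"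
      using determinesE[OF det _ _ T(3), of "\<lambda>k. k \<notin> {i, j} \<and> a k"] lies_eq[OF T(1)]
      by (metis Diff_subset subset_trans)
    have in_U: "y \<in> U" if "U \<subseteq> S - {x}" "card (lies (I - {i, j}) F a U) \<le> 1" for U
      using y(2)[of U] lies_eq[OF that(1)] that by auto
    \<comment> \<open>The element found lies in the nonempty set \<open>T\<close> itself, hence
      differs from \<open>x\<close>.\<close>
    then show "\<exists>y\<in>S - {x}. \<forall>U. U \<subseteq> S - {x} \<and> card (lies (I - {i, j}) F a U) \<le> 1 \<longrightarrow> y \<in> U"
      using T by blast
  qed
qed

text \<open>Answer YES to \<open>i\<close> and NO to \<open>j\<close>: then \<open>{x}\<close> and
  \<open>{}\<close> each account for all but one answer, so neither claim can be made.\<close>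

lemma not_determines_singleton:
  assumes "i \<noteq> j" "x \<in> F i" "x \<in> F j"
  shows "\<not> determines {x} {i, j} F"
proof
  let ?a = "\<lambda>k. k = i"
  assume det: "determines {x} {i, j} F"
  have "lies {i, j} F ?a {x} = {j}" "lies {i, j} F ?a {} = {i}"
    using assms by (auto simp: lies_def)
  then show False
    using determinesE[OF det, of "{x}" ?a] by (metis card_1_singleton_iff empty_iff
        empty_subsetI insert_not_empty order_refl One_nat_def)
qed

lemma determines_card_ge:
  assumes "finite S" "S \<noteq> {}" "finite I" "determines S I F"
  shows "2 * card S + 1 \<le> card I"
  using assms
proof (induction S arbitrary: I rule: finite_psubset_induct)
  case (psubset S)
  obtain x i j where x: "x \<in> S" and ij: "i \<in> I" "j \<in> I" "i \<noteq> j"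
    and F: "F i \<inter> S = {x}" "F j \<inter> S = {x}"
    using determines_two_singletons[OF psubset.prems(3,1)] by metis
  have card_I: "card I = card (I - {i, j}) + 2"
    using ij psubset.prems(2) card_mono[of I "{i, j}"] by (simp add: card_Diff_subset)
  have card_S: "card S = card (S - {x}) + 1"
    using x psubset.hyps by (metis Suc_eq_plus1 card_Suc_Diff1)
  show ?case
  proof (cases "S = {x}")
    case True
    have "I \<noteq> {i, j}"
      using not_determines_singleton[of i j x F] psubset.prems(3) ij F True by blast
    with ij have "I - {i, j} \<noteq> {}"
      by blast
    then show ?thesis
      using psubset.prems(2) card_I True by (simp add: Suc_le_eq card_gt_0_iff)
  next
    case False
    then have "2 * card (S - {x}) + 1 \<le> card (I - {i, j})"
      using x psubset.prems determines_remove[OF psubset.prems(3) F]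
      by (intro psubset.IH) auto
    then show ?thesis
      using card_I card_S by simp
  qed
qed

lemma solves_imp_determines:
  assumes "solves n Fs"
  shows "determines {1..n} {..<length Fs} ((!) Fs)"
  unfolding determines_def
proof
  fix a :: "nat \<Rightarrow> bool"
  let ?as = "map a [0..<length Fs]"
  have "num_lies Fs ?as T = card (lies {..<length Fs} ((!) Fs) a T)" for T
    unfolding num_lies_def lies_def by (rule arg_cong[where f = card]) auto
  moreover have "(\<exists>x \<in> {1..n}. \<forall>T. consistent n Fs ?as T \<longrightarrow> x \<in> T) \<or>
      (\<forall>T. consistent n Fs ?as T \<longrightarrow> T = {})"
    using assms by (simp add: solves_def)
  ultimately show "(\<exists>x\<in>{1..n}. \<forall>T. T \<subseteq> {1..n} \<and>
        card (lies {..<length Fs} ((!) Fs) a T) \<le> 1 \<longrightarrow> x \<in> T) \<or>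
      (\<forall>T. T \<subseteq> {1..n} \<and> card (lies {..<length Fs} ((!) Fs) a T) \<le> 1 \<longrightarrow> T = {})"
    by (simp add: consistent_def)
qed

lemma solves_length_ge:
  assumes "n \<ge> 1" "solves n Fs"
  shows "2 * n + 1 \<le> length Fs"
  using determines_card_ge[OF _ _ _ solves_imp_determines[OF assms(2)]] assms(1) by simp

section \<open>Upper bound: the doubled singletons and the whole set\<close>

definition doubled_singletons :: "nat \<Rightarrow> nat set list" where
  "doubled_singletons n =
     map (\<lambda>i. if i = 0 then {1..n} else if i \<le> n then {i} else {i - n}) [0..<2 * n + 1]"

lemma length_doubled_singletons: "length (doubled_singletons n) = 2 * n + 1"
  by (simp add: doubled_singletons_def)

lemma nth_doubled_singletons:
  "doubled_singletons n ! 0 = {1..n}"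
  "x \<in> {1..n} \<Longrightarrow> doubled_singletons n ! x = {x}"
  "x \<in> {1..n} \<Longrightarrow> doubled_singletons n ! (n + x) = {x}"
  by (auto simp: doubled_singletons_def nth_append simp del: upt_Suc)

lemma consistent_lie_unique:
  assumes "consistent n Fs as T" "i < length Fs" "j < length Fs" "i \<noteq> j"
    "as ! i \<noteq> (Fs ! i \<inter> T \<noteq> {})"
  shows "as ! j = (Fs ! j \<inter> T \<noteq> {})"
proof -
  have "card {i. i < length Fs \<and> as ! i \<noteq> (Fs ! i \<inter> T \<noteq> {})} \<le> Suc 0"
    using assms(1) by (simp add: consistent_def num_lies_def)
  then show ?thesis
    using assms(2-) by (subst (asm) card_le_Suc0_iff_eq) auto
qed

text \<open>Two YES answers on \<open>x\<close> force \<open>x\<close> into every consistent set. If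
  no element has two, each member of a consistent set costs a lie, so a nonempty consistent set is a
  singleton and the other answers are all correct. The whole-set question then separates it from the
  empty set.\<close>

lemma solves_doubled_singletons: "solves n (doubled_singletons n)"
proof -
  let ?Fs = "doubled_singletons n"
  have "multifamily n ?Fs"
    by (auto simp: multifamily_def doubled_singletons_def)
  moreover have "(\<exists>x \<in> {1..n}. \<forall>T. consistent n ?Fs as T \<longrightarrow> x \<in> T) \<or>
      (\<forall>T. consistent n ?Fs as T \<longrightarrow> T = {})" for as
  proof (cases "\<exists>x \<in> {1..n}. as ! x \<and> as ! (n + x)")
    case True
    then obtain x where x: "x \<in> {1..n}" "as ! x" "as ! (n + x)"
      by blast
    have "x \<in> T" if "consistent n ?Fs as T" for T
      using consistent_lie_unique[OF that, of x "n + x"] x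
      by (auto simp: length_doubled_singletons nth_doubled_singletons)
    with x(1) show ?thesis
      by blast
  next
    case False
    \<comment> \<open>The lie is spent at one of the two questions about \<open>x\<close>, so the
      answers to the whole set and to the other singletons are truthful.\<close>
    have single: "y = x \<and> as ! 0 \<and> (\<forall>z\<in>{1..n} - {x}. \<not> as ! z \<and> \<not> as ! (n + z))"
      if T: "consistent n ?Fs as T" and xy: "x \<in> T" "y \<in> T" for x y T
    proof -
      have sub: "T \<subseteq> {1..n}"
        using T by (simp add: consistent_def)
      with xy have x: "x \<in> {1..n}"
        by blast
      with False obtain k where k: "k = x \<or> k = n + x" "\<not> as ! k"
        by blast
      have k_lie: "as ! k \<noteq> (?Fs ! k \<inter> T \<noteq> {})" and k_bds: "k < length ?Fs" "k \<noteq> 0"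
        using k x xy(1) by (auto simp: length_doubled_singletons nth_doubled_singletons)
      have truth: "as ! j = (?Fs ! j \<inter> T \<noteq> {})" if "j < 2 * n + 1" "j \<noteq> k" for j
        using consistent_lie_unique[OF T k_bds(1) _ _ k_lie, of j] that
        by (simp add: length_doubled_singletons)
      have "as ! 0"
        using truth[of 0] k_bds x xy(1) by (auto simp: nth_doubled_singletons)
      moreover have other: "as ! z = (z \<in> T) \<and> as ! (n + z) = (z \<in> T)"
        if "z \<in> {1..n} - {x}" for z
        using truth[of z] truth[of "n + z"] k(1) x that
        by (auto simp: nth_doubled_singletons)
      \<comment> \<open>A second member would have received two YES answers.\<close>
      moreover have "T = {x}"
        using other False sub xy(1) by blast
      ultimately show ?thesis
        using xy(2) by auto
    qed
    show ?thesis
    proof (intro disjCI)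
      assume "\<not> (\<forall>T. consistent n ?Fs as T \<longrightarrow> T = {})"
      then obtain T x where T: "consistent n ?Fs as T" "x \<in> T"
        by blast
      then have x: "x \<in> {1..n}"
        by (auto simp: consistent_def)
      note T_single = single[OF T T(2)]
      have "x \<in> U" if U: "consistent n ?Fs as U" for U
      proof (cases "U = {}")
        case True
        \<comment> \<open>With \<open>as ! 0\<close> already a lie about the empty set, both answers on \<open>x\<close> are NO, which
          makes two lies about \<open>T\<close>.\<close>
        then have "\<not> as ! x \<and> \<not> as ! (n + x)"
          using consistent_lie_unique[OF U, of 0 x] consistent_lie_unique[OF U, of 0 "n + x"]
            x T_single
          by (auto simp: length_doubled_singletons nth_doubled_singletons)
        then show ?thesis
          using consistent_lie_unique[OF T(1), of x "n + x"] x T(2)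
          by (auto simp: length_doubled_singletons nth_doubled_singletons)
      next
        case False
        then obtain y where y: "y \<in> U"
          by blast
        with U have y_in: "y \<in> {1..n}"
          by (auto simp: consistent_def)
        have "y = x"
        proof (rule ccontr)
          \<comment> \<open>Both answers on \<open>y\<close> are NO by \<open>T_single\<close>,
            which is two lies about \<open>U\<close>.\<close>
          assume "y \<noteq> x"
          with T_single y_in have "\<not> as ! y" "\<not> as ! (n + y)"
            by auto
          then show False
            using consistent_lie_unique[OF U, of y "n + y"] y y_in
            by (auto simp: length_doubled_singletons nth_doubled_singletons)
        qed
        with y show ?thesis
          by simp
      qed
      with x show "\<exists>x\<in>{1..n}. \<forall>U. consistent n ?Fs as U \<longrightarrow> x \<in> U"
        by blast
    qed
  qed
  ultimately show ?thesis
    by (simp add: solves_def)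
qed

theorem theorem2p1:
  fixes n :: nat
  assumes "n \<ge> 1"
  shows "nonadaptive_complexity n = 2 * n + 1
    \<and> (\<exists>Fs. solves n Fs \<and> length Fs = 2 * n + 1)
    \<and> (\<forall>Fs. solves n Fs \<longrightarrow> 2 * n + 1 \<le> length Fs)"
proof -
  have upper: "\<exists>Fs. solves n Fs \<and> length Fs = 2 * n + 1"
    using solves_doubled_singletons length_doubled_singletons by blast
  have lower: "\<forall>Fs. solves n Fs \<longrightarrow> 2 * n + 1 \<le> length Fs"
    using solves_length_ge[OF assms] by blast
  have "nonadaptive_complexity n = 2 * n + 1"
    unfolding nonadaptive_complexity_def using upper lower by (intro Least_equality) auto
  with upper lower show ?thesis
    by blast
qed

end
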